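(* Let $k \geq 1$ be an integer and let $G$ be a $k$-connected finite simple graph of order $n$. Then \[D(G) \geq \frac12 \left(1- \frac{1}{2^k+1} \right),\] equivalently $A(G) \geq \frac{n}{2}\left(1 - \frac{1}{2^k+1}\right)$.
   Context: For a finite simple graph $G$ with vertex set $V$, a set $U \subseteq V$ is a connected set if the subgraph of $G$ induced by $U$ is connected. Let $\mathcal C(G)$ be the collection of all nonempty connected sets of $G$, let $N(G) = |\mathcal C(G)|$, and let $S(G) = \sum_{U \in \mathcal C(G)} |U|$. Define $A(G) = S(G)/N(G)$ (the average size of a nonempty connected set) and $D(G) = A(G)/n$ where $n = |V|$ (the density of connected sets). *)

theory Defs
  imports Complex_Main "Graph_Theory.Digraph_Component"
begin

text \<open>A finite simple graph is an instance of the locale \<^term>\<open>graph\<close>: a finite, loop-free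
  digraph without parallel arcs whose arc relation is symmetric, so that each undirected edge is
  represented by a pair of opposite arcs.

  The constant \<^term>\<open>Digraph_Component.connected\<close> (qualified to distinguish it from topological
  connectedness) is false for the graph without vertices.\<close>

definition connected_sets :: "('a, 'b) pre_digraph \<Rightarrow> 'a set set" where
  "connected_sets G =
     {U. U \<noteq> {} \<and> U \<subseteq> verts G \<and> Digraph_Component.connected (G \<restriction> U)}"

definition num_connected_sets :: "('a, 'b) pre_digraph \<Rightarrow> nat" where
  "num_connected_sets G = card (connected_sets G)"

definition total_connected_size :: "('a, 'b) pre_digraph \<Rightarrow> nat" where
  "total_connected_size G = (\<Sum>U\<in>connected_sets G. card U)"

definition avg_connected_size :: "('a, 'b) pre_digraph \<Rightarrow> real" where
  "avg_connected_size G = real (total_connected_size G) / real (num_connected_sets G)"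

definition connected_density :: "('a, 'b) pre_digraph \<Rightarrow> real" where
  "connected_density G = avg_connected_size G / real (card (verts G))"

text \<open>The usual convention: a \<open>k\<close>-connected graph has more than \<open>k\<close> vertices (so the complete
  graph on \<open>n\<close> vertices is \<open>k\<close>-connected exactly for \<open>k < n\<close>), and it stays connected after
  deleting any fewer than \<open>k\<close> vertices.\<close>

definition k_connected :: "nat \<Rightarrow> ('a, 'b) pre_digraph \<Rightarrow> bool" where
  "k_connected k G \<longleftrightarrow>
     card (verts G) > k \<and>
     (\<forall>X. X \<subseteq> verts G \<and> card X < k \<longrightarrow> Digraph_Component.connected (G \<restriction> (verts G - X)))"

end

theory Submission
  imports Defs
begin

text \<open>Let \<open>N\<close> count the connected sets and \<open>N\<^sub>v\<close> those containing \<open>v\<close>. In a connected graph the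
  connected sets containing a fixed vertex have average size at least \<open>(n + 1) / 2\<close>, by induction over
  the extensions of a connected set by an adjacent vertex. Removing a vertex \<open>v\<close> from a
  \<open>k\<close>-connected graph leaves a \<open>(k - 1)\<close>-connected one, so the bound for \<open>k\<close> follows from the one for
  \<open>k - 1\<close> as soon as \<open>v\<close> lies in enough connected sets; a vertex with maximal \<open>N\<^sub>v\<close> suffices.
  The base case \<open>k = 1\<close>, density at least \<open>1 / 3\<close>, is an induction on \<open>n\<close> which needs a noncut
  vertex with \<open>2 (N - N\<^sub>v) \<le> (n + 3) N\<^sub>v\<close>.\<close>

section \<open>Connected sets and components\<close>

text \<open>Choosing the vertex by maximal \<open>N\<^sub>v\<close> alone cannot settle
  \<open>k = 1\<close>: that vertex may be a cut vertex, as the centre of a star is, and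
  disconnected graphs have no positive lower bound on their density (edgeless ones have density 1 /
  n). So the base case has to choose among noncut vertices, which may lie in comparatively few
  connected sets. The critical case is the far end of a pendant path with L vertices. If R counts
  the connected sets that contain the attaching vertex and avoid the path, then about R * L sets
  cross the attaching edge, but only R of these reach the far end. The path must therefore not be
  long compared with the rest of the graph, and this is what a minimal choice of the path
  guarantees. Most counting estimates come from one device: connected sets on the two sides of an
  edge are glued along it, so that numbers of sets multiply.\<close>

locale sgraph_rel =
  fixes E :: "'a \<Rightarrow> 'a \<Rightarrow> bool"
  assumes sym: "E x y \<Longrightarrow> E y x"
    and irrefl: "\<not> E x x"
begin

text \<open>Connectedness in terms of cuts rather than paths; \<open>connected_induce_subgraph_iff\<close> relates
  it to the library notion.\<close>

definition conn :: "'a set \<Rightarrow> bool" where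
  "conn U \<longleftrightarrow> U \<noteq> {} \<and>
     (\<forall>A. A \<subseteq> U \<and> A \<noteq> {} \<and> A \<noteq> U \<longrightarrow> (\<exists>a\<in>A. \<exists>b\<in>U - A. E a b))"

lemma connD:
  assumes "conn U" "A \<subseteq> U" "A \<noteq> {}" "A \<noteq> U"
  obtains a b where "a \<in> A" "b \<in> U" "b \<notin> A" "E a b"
  using assms unfolding conn_def by blast

lemma conn_nonempty: "conn U \<Longrightarrow> U \<noteq> {}"
  by (simp add: conn_def)

lemma conn_singleton [simp]: "conn {x}"
  unfolding conn_def by blast

lemma conn_Un:
  assumes "conn U" "conn W" "U \<inter> W \<noteq> {}"
  shows "conn (U \<union> W)"
  unfolding conn_def
proof (intro conjI allI impI)
  show "U \<union> W \<noteq> {}" using assms by blast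
next
  fix A assume A: "A \<subseteq> U \<union> W \<and> A \<noteq> {} \<and> A \<noteq> U \<union> W"
  obtain p where p: "p \<in> U" "p \<in> W" using assms by blast
  have "(A \<inter> U \<noteq> {} \<and> A \<inter> U \<noteq> U) \<or> (A \<inter> W \<noteq> {} \<and> A \<inter> W \<noteq> W)"
    using A p by blast
  then show "\<exists>a\<in>A. \<exists>b\<in>U \<union> W - A. E a b"
  proof
    assume h: "A \<inter> U \<noteq> {} \<and> A \<inter> U \<noteq> U"
    show ?thesis by (rule connD[OF assms(1), of "A \<inter> U"]) (use h in blast)+
  next
    assume h: "A \<inter> W \<noteq> {} \<and> A \<inter> W \<noteq> W"
    show ?thesis by (rule connD[OF assms(2), of "A \<inter> W"]) (use h in blast)+
  qed
qed

lemma conn_edge: "E x y \<Longrightarrow> conn {x, y}"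
  unfolding conn_def using sym by blast

lemma conn_Un_edge:
  assumes "conn U" "conn W" "x \<in> U" "y \<in> W" "E x y"
  shows "conn (U \<union> W)"
proof -
  have "conn (U \<union> {x, y})" using assms conn_edge[of x y] by (intro conn_Un) blast+
  then have "conn (U \<union> {x, y} \<union> W)" by (rule conn_Un) (use assms in auto)
  moreover have "U \<union> {x, y} \<union> W = U \<union> W" using assms by blast
  ultimately show ?thesis by simp
qed

lemma conn_insert:
  assumes "conn U" "x \<in> U" "E x y \<or> E y x"
  shows "conn (insert y U)"
  using conn_Un_edge[of U "{y}" x y] assms sym by auto

lemma conn_exit:
  assumes "conn V" "U \<subset> V" "U \<noteq> {}"
  obtains u y where "u \<in> U" "y \<in> V - U" "E u y"
  using connD[OF assms(1), of U] assms by (metis DiffI psubset_imp_subset psubset_eq)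

text \<open>A largest proper connected superset of \<open>U\<close> lacks exactly one vertex, since
  adding a neighbour keeps it connected.\<close>

lemma ex_noncut:
  assumes "finite V" "conn V" "conn U" "U \<subset> V"
  obtains v where "v \<in> V - U" "conn (V - {v})"
proof -
  let ?P = "\<lambda>W. U \<subseteq> W \<and> W \<subset> V \<and> conn W"
  have "\<exists>W. ?P W \<and> (\<forall>W'. ?P W' \<longrightarrow> card W' \<le> card W)"
  proof (rule ex_has_greatest_nat[of ?P U card "card V + 1"])
    show "?P U" using assms by blast
    show "\<forall>W. ?P W \<longrightarrow> card W < card V + 1"
      using assms(1) by (metis Suc_eq_plus1 card_mono less_Suc_eq_le psubset_imp_subset)
  qed
  then obtain W where W: "?P W" "\<And>W'. ?P W' \<Longrightarrow> card W' \<le> card W" by blast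
  obtain u y where uy: "u \<in> W" "y \<in> V - W" "E u y"
    by (rule conn_exit[OF assms(2), of W]) (use W(1) conn_nonempty in blast)+
  have fW: "finite W" using W(1) assms(1) finite_subset by blast
  have "insert y W = V"
  proof (rule ccontr)
    assume "insert y W \<noteq> V"
    then have "?P (insert y W)" using W(1) uy conn_insert by blast
    from W(2)[OF this] show False using uy fW by simp
  qed
  then have "V - {y} = W" using uy by blast
  then show ?thesis using that[of y] W(1) uy by auto
qed

section \<open>Components of a vertex set\<close>

definition component :: "'a set \<Rightarrow> 'a \<Rightarrow> 'a set" where
  "component S x = \<Union>{U. conn U \<and> U \<subseteq> S \<and> x \<in> U}"

definition components :: "'a set \<Rightarrow> 'a set set" where
  "components S = component S ` S"

lemma conn_Union:
  assumes "\<And>U. U \<in> F \<Longrightarrow> conn U" "\<And>U. U \<in> F \<Longrightarrow> x \<in> U" "F \<noteq> {}"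
  shows "conn (\<Union>F)"
  unfolding conn_def
proof (intro conjI allI impI)
  show "\<Union>F \<noteq> {}" using assms by blast
next
  fix A assume A: "A \<subseteq> \<Union>F \<and> A \<noteq> {} \<and> A \<noteq> \<Union>F"
  have "\<exists>U\<in>F. A \<inter> U \<noteq> {} \<and> A \<inter> U \<noteq> U"
  proof (cases "x \<in> A")
    case True
    with A obtain b U where "U \<in> F" "b \<in> U" "b \<notin> A" by blast
    then show ?thesis using True assms(2) by blast
  next
    case False
    with A obtain b U where "U \<in> F" "b \<in> U" "b \<in> A" by blast
    then show ?thesis using False assms(2) by blast
  qed
  then obtain U where U: "U \<in> F" "A \<inter> U \<noteq> {}" "A \<inter> U \<noteq> U" by blast
  show "\<exists>a\<in>A. \<exists>b\<in>\<Union>F - A. E a b"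
    by (rule connD[OF assms(1)[OF U(1)], of "A \<inter> U"]) (use U in blast)+
qed

lemma component_conn: "x \<in> S \<Longrightarrow> conn (component S x)"
  unfolding component_def by (rule conn_Union[of _ x]) (auto intro: exI[of _ "{x}"])

lemma component_self: "x \<in> S \<Longrightarrow> x \<in> component S x"
  unfolding component_def by (auto intro: exI[of _ "{x}"])

lemma component_subset: "component S x \<subseteq> S"
  unfolding component_def by auto

lemma component_max: "conn U \<Longrightarrow> U \<subseteq> S \<Longrightarrow> x \<in> U \<Longrightarrow> U \<subseteq> component S x"
  unfolding component_def by auto

lemma components_conn: "K \<in> components S \<Longrightarrow> conn K"
  using component_conn components_def by auto

lemma components_subset: "K \<in> components S \<Longrightarrow> K \<subseteq> S"
  using component_subset components_def by auto

lemma components_max: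
  assumes "K \<in> components S" "conn U" "U \<subseteq> S" "U \<inter> K \<noteq> {}"
  shows "U \<subseteq> K"
proof -
  obtain x where x: "x \<in> S" "K = component S x" using assms(1) components_def by auto
  have "conn (K \<union> U)" using conn_Un[of K U] assms components_conn by blast
  then have "K \<union> U \<subseteq> component S x"
    using x component_self components_subset[OF assms(1)] assms(3) by (intro component_max) auto
  then show ?thesis using x by blast
qed

lemma components_disjoint: "K \<in> components S \<Longrightarrow> K' \<in> components S \<Longrightarrow> K \<noteq> K' \<Longrightarrow> K \<inter> K' = {}"
  using components_max[of K S K'] components_max[of K' S K] components_conn components_subset by blast

lemma components_cover: "\<Union>(components S) = S"
  using component_self components_subset components_def by blast

lemma finite_components: "finite S \<Longrightarrow> finite (components S)"
  by (simp add: components_def)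

lemma components_I:
  assumes "K \<subseteq> S" "conn K" "\<And>a b. a \<in> K \<Longrightarrow> b \<in> S - K \<Longrightarrow> \<not> E a b"
  shows "K \<in> components S"
proof -
  obtain x where x: "x \<in> K" using assms conn_nonempty by blast
  have 1: "K \<subseteq> component S x" using component_max assms x by blast
  have "conn (component S x)" using x assms component_conn by blast
  have "K = component S x"
  proof (rule ccontr)
    assume "K \<noteq> component S x"
    then obtain a b where "a \<in> K" "b \<in> component S x" "b \<notin> K" "E a b"
      using connD[of "component S x" K] 1 x \<open>conn (component S x)\<close> by blast
    then show False using assms(3) component_subset by blast
  qed
  then show ?thesis using x assms components_def by auto
qed

lemma components_no_edge:
  assumes "K \<in> components S" "a \<in> K" "b \<in> S - K"
  shows "\<not> E a b"
proof
  assume "E a b"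
  then have "conn (insert b K)" using conn_insert components_conn assms by blast
  then have "insert b K \<subseteq> K" using assms components_subset by (intro components_max[of K S]) auto
  then show False using assms by blast
qed

lemma components_not_conn:
  assumes "S \<noteq> {}" "\<not> conn S" "K \<in> components S"
  obtains K' where "K' \<in> components S" "K' \<noteq> K"
proof -
  have "K \<noteq> S" using assms components_conn by blast
  then obtain y where "y \<in> S" "y \<notin> K" using components_subset assms by blast
  then show ?thesis using that components_cover by blast
qed

lemma components_adj:
  assumes "conn V" "v \<in> V" "K \<in> components (V - {v})"
  obtains x where "x \<in> K" "E v x"
proof -
  have "K \<subset> V" "K \<noteq> {}" using assms components_subset components_conn conn_nonempty by blast+
  then obtain a b where ab: "a \<in> K" "b \<in> V - K" "E a b" using conn_exit[OF assms(1)] by blast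
  then have "b = v" using components_no_edge[OF assms(3), of a b] by blast
  then show ?thesis using that ab sym by blast
qed

text \<open>Every other component has a neighbour of \<open>v\<close>, so these components, each
  enlarged by \<open>v\<close>, are connected and share \<open>v\<close>.\<close>

lemma conn_Diff_component:
  assumes "conn V" "v \<in> V" "K \<in> components (V - {v})"
  shows "conn (V - K)"
proof -
  let ?F = "insert {v} ((\<lambda>C. insert v C) ` (components (V - {v}) - {K}))"
  have "conn (\<Union>?F)"
  proof (rule conn_Union[of _ v])
    fix U assume "U \<in> ?F"
    then have "U = {v} \<or> U \<in> insert v ` (components (V - {v}) - {K})" by blast
    then show "conn U"
    proof
      assume "U = {v}"
      then show ?thesis by simp
    next
      assume "U \<in> insert v ` (components (V - {v}) - {K})"
      then obtain C where C: "C \<in> components (V - {v})" "U = insert v C" by blast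
      obtain y where "y \<in> C" "E v y" using components_adj[OF assms(1,2) C(1)] .
      then show ?thesis using C components_conn conn_insert by blast
    qed
  qed auto
  moreover have "\<Union>?F = insert v (\<Union>(components (V - {v}) - {K}))" by auto
  moreover have "\<Union>(components (V - {v}) - {K}) = \<Union>(components (V - {v})) - K"
    using components_disjoint[OF _ assms(3)] by auto
  moreover have "insert v (\<Union>(components (V - {v})) - K) = V - K"
    using components_subset[OF assms(3)] assms(2) by (auto simp: components_cover)
  ultimately show ?thesis by simp
qed

text \<open>An edge across a cut of \<open>V\<close> is lost only if it joins \<open>w\<close> to
  \<open>u\<close>. Of a part of \<open>V - {w}\<close> and its complement there, the one without
  \<open>u\<close> therefore has a leaving edge that survives.\<close>

lemma conn_remove_leaf:
  assumes "conn V" "V \<noteq> {w}" and u: "\<And>y. y \<in> V \<Longrightarrow> E w y \<Longrightarrow> y = u"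
  shows "conn (V - {w})"
  unfolding conn_def
proof (intro conjI allI impI)
  show "V - {w} \<noteq> {}" using assms conn_nonempty by blast
next
  fix A assume A: "A \<subseteq> V - {w} \<and> A \<noteq> {} \<and> A \<noteq> V - {w}"
  show "\<exists>a\<in>A. \<exists>b\<in>V - {w} - A. E a b"
  proof (cases "u \<in> A")
    case False
    obtain a b where "a \<in> A" "b \<in> V" "b \<notin> A" "E a b" using connD[OF assms(1), of A] A by blast
    moreover from this have "b \<noteq> w" using u[of a] False A sym by blast
    ultimately show ?thesis by blast
  next
    case True
    let ?B = "V - {w} - A"
    obtain a b where "a \<in> ?B" "b \<in> V" "b \<notin> ?B" "E a b"
      using connD[OF assms(1), of ?B] A by blast
    moreover from this have "b \<noteq> w" using u[of a] True A sym by blast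
    ultimately show ?thesis using sym by blast
  qed
qed

section \<open>Counting connected sets\<close>

definition cs :: "'a set \<Rightarrow> 'a set set" where
  "cs V = {U. U \<subseteq> V \<and> conn U}"

text \<open>A whole set \<open>H\<close> instead of a single vertex, because the induction for the
  average size enlarges \<open>H\<close> vertex by vertex.\<close>

definition cs_above :: "'a set \<Rightarrow> 'a set \<Rightarrow> 'a set set" where
  "cs_above H V = {U \<in> cs V. H \<subseteq> U}"

lemma finite_cs [simp]: "finite V \<Longrightarrow> finite (cs V)"
  unfolding cs_def by simp

lemma finite_cs_above [simp]: "finite V \<Longrightarrow> finite (cs_above H V)"
  unfolding cs_above_def by simp

lemma cs_split: "cs V = cs_above {v} V \<union> cs (V - {v})" "cs_above {v} V \<inter> cs (V - {v}) = {}"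
  unfolding cs_above_def cs_def by auto

lemma card_cs_split:
  "finite V \<Longrightarrow> card (cs V) = card (cs_above {v} V) + card (cs (V - {v}))"
  by (metis cs_split card_Un_disjoint finite_cs finite_cs_above finite_Diff)

text \<open>Deleting noncut vertices other than \<open>v\<close> one at a time leaves a chain of
  \<open>card V\<close> connected sets that contain \<open>v\<close>.\<close>

lemma card_cs_above_ge:
  "finite V \<Longrightarrow> conn V \<Longrightarrow> v \<in> V \<Longrightarrow> card V \<le> card (cs_above {v} V)"
proof (induction "card V" arbitrary: V rule: less_induct)
  case less
  show ?case
  proof (cases "V = {v}")
    case True
    then have "V \<in> cs_above {v} V" unfolding cs_above_def cs_def using less by auto
    then have "card (cs_above {v} V) > 0" using less by (auto simp: card_gt_0_iff)
    then show ?thesis using True by simp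
  next
    case False
    then have "{v} \<subset> V" using less by blast
    then obtain w where w: "w \<in> V - {v}" "conn (V - {w})"
      using ex_noncut[of V "{v}"] less by auto
    have IH: "card (V - {w}) \<le> card (cs_above {v} (V - {w}))"
      using less.hyps[of "V - {w}"] w less.prems card_Diff1_less[of V w] by blast
    have "insert V (cs_above {v} (V - {w})) \<subseteq> cs_above {v} V"
      unfolding cs_above_def cs_def using less.prems by auto
    moreover have "V \<notin> cs_above {v} (V - {w})"
      unfolding cs_above_def cs_def using w by auto
    ultimately have "card (cs_above {v} (V - {w})) + 1 \<le> card (cs_above {v} V)"
      using card_mono[of "cs_above {v} V" "insert V (cs_above {v} (V - {w}))"] less.prems by auto
    then show ?thesis using IH w less.prems by (simp add: card_Diff_singleton)
  qed
qed

text \<open>The edge joins a set on the side \<open>A\<close> to one on the side \<open>B\<close>;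
  as the sides are disjoint, the union determines both.\<close>

lemma card_cs_above_mult:
  assumes "finite V" "A \<subseteq> V" "B \<subseteq> V" "A \<inter> B = {}" "x \<in> H" "u \<in> B" "E x u"
  shows "card (cs_above H A) * card (cs_above {u} B) \<le> card (cs_above (insert u H) V)"
proof -
  have fin: "finite A" "finite B" using assms finite_subset by blast+
  let ?f = "\<lambda>(U, W). U \<union> W"
  have "inj_on ?f (cs_above H A \<times> cs_above {u} B)"
  proof (rule inj_onI)
    fix p q assume h: "p \<in> cs_above H A \<times> cs_above {u} B" "q \<in> cs_above H A \<times> cs_above {u} B" "?f p = ?f q"
    have "fst r = ?f r \<inter> A \<and> snd r = ?f r \<inter> B" if "r \<in> cs_above H A \<times> cs_above {u} B" for r
      using that assms(4) unfolding cs_above_def cs_def by auto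
    from this[OF h(1)] this[OF h(2)] h(3) show "p = q" by (simp add: prod_eq_iff)
  qed
  moreover have "?f ` (cs_above H A \<times> cs_above {u} B) \<subseteq> cs_above (insert u H) V"
  proof (clarsimp simp: cs_above_def cs_def)
    fix U W assume h: "U \<subseteq> A" "conn U" "H \<subseteq> U" "W \<subseteq> B" "conn W" "u \<in> W"
    then have "conn (U \<union> W)" using assms by (intro conn_Un_edge[of U W x u]) auto
    then show "U \<subseteq> V \<and> W \<subseteq> V \<and> conn (U \<union> W) \<and> H \<subseteq> U \<union> W"
      using h assms by blast
  qed
  ultimately have "card (cs_above H A \<times> cs_above {u} B) \<le> card (cs_above (insert u H) V)"
    using assms by (intro card_inj_on_le) auto
  then show ?thesis by (simp add: card_cartesian_product)
qed

lemma cs_above_mono: "H \<subseteq> H' \<Longrightarrow> V' \<subseteq> V \<Longrightarrow> cs_above H' V' \<subseteq> cs_above H V"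
  unfolding cs_above_def cs_def by auto

lemma card_cs_above_mono:
  "finite V \<Longrightarrow> H \<subseteq> H' \<Longrightarrow> V' \<subseteq> V \<Longrightarrow> card (cs_above H' V') \<le> card (cs_above H V)"
  by (intro card_mono cs_above_mono) auto

text \<open>Let \<open>u\<close> be adjacent to \<open>H\<close>. On sets containing
  \<open>u\<close> the induction hypothesis for \<open>insert u H\<close> leaves a surplus of 1 per
  set. The others lie in the component \<open>K\<close> of \<open>V - {u}\<close> around
  \<open>H\<close>, and the hypothesis for \<open>K\<close> falls short by
  \<open>card (V - K)\<close> per set. The surplus has to cover the shortfall.\<close>

lemma sum_cs_above_ge:
  assumes "finite V" "conn V" "conn H" "H \<subseteq> V"
  shows "(\<Sum>U\<in>cs_above H V. 2 * int (card U) - int (card V) - int (card H)) \<ge> 0"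
  using assms
proof (induction "card (V - H)" arbitrary: V H rule: less_induct)
  case less
  show ?case
  proof (cases "H = V")
    case True
    then have "cs_above H V = {V}" unfolding cs_above_def cs_def using less.prems by auto
    then show ?thesis using True by simp
  next
    case False
    obtain x u where xu: "x \<in> H" "u \<in> V - H" "E x u"
      by (rule conn_exit[OF less.prems(2), of H]) (use False less.prems conn_nonempty in blast)+
    have finH: "finite H" using less.prems finite_subset by blast
    define K where "K = component (V - {u}) x"
    have x: "x \<in> V - {u}" using xu less.prems by auto
    have K: "K \<in> components (V - {u})" "conn K" "K \<subseteq> V - {u}"
      unfolding K_def components_def using x component_conn component_subset by blast+
    have HK: "H \<subseteq> K"
      unfolding K_def using xu less.prems by (intro component_max) auto
    have finK: "finite K" using K HK less.prems finite_subset by blast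
    let ?A = "cs_above (insert u H) V" and ?B = "cs_above H K"
    have split: "cs_above H V = ?A \<union> ?B" "?A \<inter> ?B = {}"
    proof -
      have "U \<subseteq> K" if "conn U" "U \<subseteq> V - {u}" "H \<subseteq> U" for U
        unfolding K_def using that xu by (intro component_max) auto
      then show "cs_above H V = ?A \<union> ?B" "?A \<inter> ?B = {}"
        unfolding cs_above_def cs_def using K HK by auto
    qed
    have VH: "card (V - insert u H) < card (V - H)"
      using xu less.prems by (intro psubset_card_mono) auto
    have KH: "card (K - H) < card (V - H)"
      using xu K HK less.prems by (intro psubset_card_mono) auto
    have IHA: "(\<Sum>U\<in>?A. 2 * int (card U) - int (card V) - int (card (insert u H))) \<ge> 0"
      using less.hyps[OF VH] less.prems xu conn_insert by auto
    have IHB: "(\<Sum>U\<in>?B. 2 * int (card U) - int (card K) - int (card H)) \<ge> 0"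
      using less.hyps[OF KH] less.prems K HK finK by auto
    have cK: "card V - card K = card (V - K)" "card K \<le> card V"
      using K finK less.prems by (auto intro!: card_Diff_subset[symmetric] card_mono)
    \<comment> \<open>Each set inside \<open>K\<close> can be glued to any connected set of
      \<open>V - K\<close> containing \<open>u\<close>, so it is matched by at least
      \<open>card (V - K)\<close> sets of \<open>?A\<close>, one for each unit of its
      shortfall.\<close>
    have "card (V - K) \<le> card (cs_above {u} (V - K))"
      using conn_Diff_component[OF less.prems(2) _ K(1)] K HK xu less.prems
      by (intro card_cs_above_ge) auto
    then have "card ?B * card (V - K) \<le> card ?B * card (cs_above {u} (V - K))" by simp
    also have "\<dots> \<le> card ?A"
      using less.prems K HK xu by (intro card_cs_above_mult[of V K "V - K" x]) auto
    finally have *: "int (card ?B) * (int (card V) - int (card K)) \<le> int (card ?A)"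
      using cK by (metis of_nat_diff of_nat_le_iff of_nat_mult)
    have "(\<Sum>U\<in>cs_above H V. 2 * int (card U) - int (card V) - int (card H))
        = (\<Sum>U\<in>?A. 2 * int (card U) - int (card V) - int (card H))
        + (\<Sum>U\<in>?B. 2 * int (card U) - int (card V) - int (card H))"
      unfolding split(1) using split(2) less.prems finK by (intro sum.union_disjoint) auto
    also have "(\<Sum>U\<in>?A. 2 * int (card U) - int (card V) - int (card H))
        = (\<Sum>U\<in>?A. (2 * int (card U) - int (card V) - int (card (insert u H))) + 1)"
      using xu finH by (intro sum.cong) auto
    also have "\<dots> = (\<Sum>U\<in>?A. 2 * int (card U) - int (card V) - int (card (insert u H))) + int (card ?A)"
      by (subst sum.distrib) simp
    also have "(\<Sum>U\<in>?B. 2 * int (card U) - int (card V) - int (card H))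
        = (\<Sum>U\<in>?B. (2 * int (card U) - int (card K) - int (card H)) + (int (card K) - int (card V)))"
      by (intro sum.cong) auto
    also have "\<dots> = (\<Sum>U\<in>?B. 2 * int (card U) - int (card K) - int (card H))
        - int (card ?B) * (int (card V) - int (card K))"
      by (subst sum.distrib) (simp add: algebra_simps)
    finally show ?thesis using IHA IHB * by linarith
  qed
qed

section \<open>All connected sets against those containing one vertex\<close>

lemma cs_components: "cs S = (\<Union>K\<in>components S. cs K)"
proof (intro set_eqI iffI)
  fix U assume "U \<in> cs S"
  then have U: "conn U" "U \<subseteq> S" by (auto simp: cs_def)
  then obtain x where "x \<in> U" using conn_nonempty by blast
  then show "U \<in> (\<Union>K\<in>components S. cs K)" using U component_max[of U S x] unfolding cs_def components_def by blast
next
  fix U assume "U \<in> (\<Union>K\<in>components S. cs K)"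
  then show "U \<in> cs S" using components_subset by (auto simp: cs_def)
qed

lemma card_cs_components:
  assumes "finite S"
  shows "card (cs S) = (\<Sum>K\<in>components S. card (cs K))"
  unfolding cs_components[of S]
proof (rule card_UN_disjoint)
  show "finite (components S)" using assms finite_components by blast
  show "\<forall>i\<in>components S. finite (cs i)" using assms components_subset finite_subset finite_cs by metis
  show "\<forall>i\<in>components S. \<forall>j\<in>components S. i \<noteq> j \<longrightarrow> cs i \<inter> cs j = {}"
  proof (intro ballI impI)
    fix i j assume "i \<in> components S" "j \<in> components S" "i \<noteq> j"
    from components_disjoint[OF this] show "cs i \<inter> cs j = {}"
      unfolding cs_def using conn_nonempty by blast
  qed
qed

lemma card_components:
  assumes "finite S"
  shows "card S = (\<Sum>K\<in>components S. card K)"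
proof -
  have "card (\<Union>K\<in>components S. K) = (\<Sum>K\<in>components S. card K)"
  proof (rule card_UN_disjoint)
    show "finite (components S)" using assms by (rule finite_components)
    show "\<forall>K\<in>components S. finite K" using assms components_subset finite_subset by metis
    show "\<forall>K\<in>components S. \<forall>K'\<in>components S. K \<noteq> K' \<longrightarrow> K \<inter> K' = {}"
      using components_disjoint by simp
  qed
  then show ?thesis using components_cover by auto
qed

lemma card_cs_above_neighbour:
  assumes "finite V" "v \<in> V" "K \<subseteq> V - {v}" "x \<in> K" "E v x"
  shows "card (cs_above {x} K) \<le> card (cs_above {v} V)"
proof -
  have "card (cs_above {x} K) * card (cs_above {v} {v}) \<le> card (cs_above {v, x} V)"
    using assms sym by (intro card_cs_above_mult[of _ _ _ x]) auto
  moreover have "card (cs_above {v} {v}) \<ge> 1" using card_cs_above_ge[of "{v}" v] by simp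
  moreover have "card (cs_above {v, x} V) \<le> card (cs_above {v} V)"
    using assms by (intro card_cs_above_mono) auto
  ultimately show ?thesis
    by (metis dual_order.trans mult.right_neutral mult_le_mono2)
qed

text \<open>Induction over the components \<open>K\<close> of \<open>V - {v}\<close>: each has a
  neighbour \<open>x\<close> of \<open>v\<close>, and adding \<open>v\<close> turns sets of
  \<open>K\<close> containing \<open>x\<close> into sets containing \<open>v\<close>.\<close>

lemma card_cs_le:
  "finite V \<Longrightarrow> conn V \<Longrightarrow> v \<in> V \<Longrightarrow> card (cs V) \<le> card V * card (cs_above {v} V)"
proof (induction "card V" arbitrary: V v rule: less_induct)
  case less
  let ?P = "card (cs_above {v} V)"
  have "card (cs K) \<le> card K * ?P" if K: "K \<in> components (V - {v})" for K
  proof -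
    obtain x where x: "x \<in> K" "E v x" using components_adj less.prems K by blast
    have KV: "K \<subset> V" using components_subset[OF K] less.prems by blast
    then have "card K < card V" "finite K" using less.prems psubset_card_mono finite_subset by auto
    then have "card (cs K) \<le> card K * card (cs_above {x} K)"
      using less.hyps[of K x] components_conn[OF K] x by blast
    also have "\<dots> \<le> card K * ?P"
      using card_cs_above_neighbour[of V v K x] less.prems components_subset[OF K] x by simp
    finally show ?thesis .
  qed
  then have "(\<Sum>K\<in>components (V - {v}). card (cs K)) \<le> (\<Sum>K\<in>components (V - {v}). card K * ?P)"
    by (rule sum_mono)
  also have "\<dots> = card (V - {v}) * ?P"
    using card_components[of "V - {v}"] less.prems by (simp add: sum_distrib_right)
  finally have "card (cs (V - {v})) \<le> card (V - {v}) * ?P"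
    using card_cs_components[of "V - {v}"] less.prems by simp
  moreover have "Suc (card (V - {v})) * ?P = card V * ?P"
    using card.remove[OF less.prems(1,3)] by simp
  moreover have "card (cs V) = ?P + card (cs (V - {v}))" using card_cs_split less.prems by blast
  ultimately show ?case by (metis add_left_mono mult_Suc)
qed

text \<open>A second component is worth a factor: sets of \<open>K\<close> containing a neighbour of
  \<open>z\<close> can be glued to each of the at least \<open>1 + card K'\<close> connected sets of
  \<open>insert z K'\<close> containing \<open>z\<close>.\<close>

lemma card_cs_components_le:
  assumes "finite Z" "conn Z" "z \<in> Z" "K \<in> components (Z - {z})" "K' \<in> components (Z - {z})" "K \<noteq> K'"
  shows "(1 + card K') * card (cs K) \<le> card K * card (cs_above {z} Z)"
proof -
  obtain x where x: "x \<in> K" "E z x" using components_adj assms by blast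
  obtain x' where x': "x' \<in> K'" "E z x'" using components_adj assms by blast
  have sub: "K \<subseteq> Z - {z}" "K' \<subseteq> Z - {z}" using components_subset assms by auto
  have fin: "finite K" "finite K'" using sub assms(1) finite_subset by blast+
  have "conn (insert z K')" using conn_insert x' components_conn assms by blast
  then have "card (insert z K') \<le> card (cs_above {z} (insert z K'))"
    using fin by (intro card_cs_above_ge) auto
  then have 1: "1 + card K' \<le> card (cs_above {z} (insert z K'))" using sub fin by (subst (asm) card_insert_disjoint) auto
  have "card (cs_above {x} K) * card (cs_above {z} (insert z K')) \<le> card (cs_above {z, x} Z)"
    using assms sub x sym components_disjoint[of K "Z - {z}" K']
    by (intro card_cs_above_mult[of _ _ _ x]) auto
  also have "\<dots> \<le> card (cs_above {z} Z)" using assms by (intro card_cs_above_mono) auto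
  finally have 2: "card (cs_above {x} K) * card (cs_above {z} (insert z K')) \<le> card (cs_above {z} Z)" .
  have 3: "card (cs K) \<le> card K * card (cs_above {x} K)"
    using card_cs_le fin components_conn assms x by blast
  have "(1 + card K') * card (cs K)
      \<le> card (cs_above {z} (insert z K')) * (card K * card (cs_above {x} K))"
    using 1 3 by (rule mult_le_mono)
  also have "\<dots> = card K * (card (cs_above {x} K) * card (cs_above {z} (insert z K')))" by simp
  also have "\<dots> \<le> card K * card (cs_above {z} Z)" using 2 by simp
  finally show ?thesis .
qed

lemma card_cs_components_le_half:
  assumes "finite Z" "conn Z" "z \<in> Z" "K \<in> components (Z - {z})" "K' \<in> components (Z - {z})" "K \<noteq> K'"
  shows "2 * card (cs K) \<le> card K * card (cs_above {z} Z)"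
proof -
  have "finite K'" using components_subset[OF assms(5)] assms(1) by (meson finite_Diff finite_subset)
  moreover have "K' \<noteq> {}" using components_conn[OF assms(5)] conn_nonempty by blast
  ultimately have "2 \<le> 1 + card K'" by (simp add: Suc_le_eq card_gt_0_iff)
  then have "2 * card (cs K) \<le> (1 + card K') * card (cs K)" by (rule mult_le_mono1)
  then show ?thesis using card_cs_components_le[OF assms] by linarith
qed

lemma card_cs_le_of_components:
  assumes "finite S" "\<And>K. K \<in> components S \<Longrightarrow> c * card (cs K) \<le> card K * P"
  shows "c * card (cs S) \<le> card S * P"
  unfolding card_cs_components[OF assms(1)] card_components[OF assms(1)] sum_distrib_left
    sum_distrib_right using assms(2) by (rule sum_mono)

section \<open>Degrees, cut vertices and paths\<close>

definition nb :: "'a set \<Rightarrow> 'a \<Rightarrow> 'a set" where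
  "nb V v = {u \<in> V. E v u}"

lemma finite_nb [simp]: "finite V \<Longrightarrow> finite (nb V v)"
  by (simp add: nb_def)

lemma card_ge_2D:
  assumes "2 \<le> card S"
  obtains a b where "a \<in> S" "b \<in> S" "a \<noteq> b"
proof -
  have "finite S" using assms by (metis card.infinite not_numeral_le_zero)
  then show ?thesis using assms that card_le_Suc0_iff_eq[of S] by fastforce
qed

text \<open>One neighbour of \<open>v\<close> would give the estimate without the factor 2. The
  second neighbour supplies a disjoint family of connected sets to which \<open>v\<close> can be
  added.\<close>

lemma card_cs_Diff_noncut:
  assumes V: "finite V" "conn V" "v \<in> V" "conn (V - {v})" and "2 \<le> card (nb V v)"
  shows "2 * card (cs (V - {v})) \<le> card V * card (cs_above {v} V)"
proof -
  obtain u1 u2 where u: "u1 \<in> V" "E v u1" "u2 \<in> V" "E v u2" "u1 \<noteq> u2"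
    using card_ge_2D[OF assms(5)] unfolding nb_def by blast
  define M where "M = V - {v}"
  define P where "P = card (cs_above {v} V)"
  have M: "finite M" "conn M" "u1 \<in> M" "u2 \<in> M" "v \<notin> M" "M \<subseteq> V"
    using V u irrefl unfolding M_def by auto
  define K1 where "K1 = component (M - {u1}) u2"
  have K1: "K1 \<in> components (M - {u1})" "u2 \<in> K1"
    using M u component_self unfolding K1_def components_def by auto
  have K1M: "K1 \<subseteq> M - {u1}" using components_subset K1 by blast
  let ?A = "cs_above {u1} M" and ?B = "cs_above {u2} K1"
  \<comment> \<open>Members of \<open>?A\<close> contain \<open>u1\<close>, those of
    \<open>?B\<close> contain \<open>u2\<close> but not \<open>u1\<close>; adding \<open>v\<close>
    makes all of them distinct members of \<open>cs_above {v} V\<close>.\<close>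
  have "card ?A + card ?B = card (?A \<union> ?B)"
  proof (rule card_Un_disjoint[symmetric])
    show "finite ?B" using K1M M(1) by (meson finite_Diff finite_subset finite_cs_above)
    show "?A \<inter> ?B = {}" using K1M by (auto simp: cs_above_def cs_def)
  qed (use M in simp)
  also have "\<dots> \<le> P"
    unfolding P_def
  proof (rule card_inj_on_le[of "insert v"])
    show "inj_on (insert v) (?A \<union> ?B)"
      using M K1M by (intro inj_onI) (auto simp: cs_above_def cs_def)
    have "conn (insert v U)" if "conn U" "u1 \<in> U \<or> u2 \<in> U" for U
      using conn_insert[of U _ v] that u by blast
    then show "insert v ` (?A \<union> ?B) \<subseteq> cs_above {v} V"
      using M K1M V by (auto simp: cs_above_def cs_def)
    show "finite (cs_above {v} V)" using V by simp
  qed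
  finally have AB: "card ?A + card ?B \<le> P" .
  have "2 * card (cs K) \<le> card K * P" if K: "K \<in> components (M - {u1})" for K
  proof (cases "K = K1")
    case True
    obtain x where x: "x \<in> K1" "E u1 x" using components_adj M K1 by blast
    have fK: "finite K1" "conn K1" using K1M M finite_subset components_conn K1 by blast+
    \<comment> \<open>The component of \<open>u2\<close> is bounded twice, through \<open>u2\<close>
      and through \<open>u1\<close>, and the bounds are added. Every other component has
      \<open>K1\<close> as its partner.\<close>
    have "card (cs K1) \<le> card K1 * card ?B" using card_cs_le fK K1 by blast
    moreover have "card (cs K1) \<le> card K1 * card (cs_above {x} K1)" using card_cs_le fK x by blast
    moreover have "card (cs_above {x} K1) \<le> card ?A"
      using card_cs_above_neighbour[of M u1 K1 x] M K1M x by blast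
    then have "card K1 * card (cs_above {x} K1) \<le> card K1 * card ?A" by simp
    ultimately have "2 * card (cs K1) \<le> card K1 * (card ?A + card ?B)"
      unfolding distrib_left by linarith
    also have "\<dots> \<le> card K1 * P" using AB by simp
    finally show ?thesis using True by simp
  next
    case False
    have "2 * card (cs K) \<le> card K * card ?A"
      using card_cs_components_le_half[OF M(1,2,3) K K1(1) False] .
    also have "\<dots> \<le> card K * P" using AB by simp
    finally show ?thesis .
  qed
  then have "2 * card (cs (M - {u1})) \<le> card (M - {u1}) * P"
    using card_cs_le_of_components[of "M - {u1}" 2 P] M(1) by blast
  moreover have "card V = card (M - {u1}) + 2"
    using card.remove[of V v] card.remove[of M u1] V M unfolding M_def by linarith
  moreover have "card (cs M) = card ?A + card (cs (M - {u1}))"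
    using card_cs_split M by blast
  moreover have "(card (M - {u1}) + 2) * P = card (M - {u1}) * P + 2 * P" by (rule add_mult_distrib)
  ultimately have "2 * card (cs M) \<le> card V * P" using AB by simp
  then show ?thesis unfolding M_def P_def .
qed

text \<open>A component that is not the largest has at most \<open>card (cs_above {z} Z)\<close>
  connected sets, whatever its size. Its size thus drops out of the total, which gains
  \<open>l\<close>. The gain stands on the left to avoid subtraction of naturals.\<close>

lemma card_cs_cut:
  assumes Z: "finite Z" "conn Z" "z \<in> Z" "Z \<noteq> {z}" "\<not> conn (Z - {z})"
    and l: "\<And>K. K \<in> components (Z - {z}) \<Longrightarrow> l \<le> card K"
  shows "2 * card (cs Z) + l * card (cs_above {z} Z) \<le> card (cs_above {z} Z) * (card Z + 3)"
proof -
  define C where "C = components (Z - {z})"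
  define P where "P = card (cs_above {z} Z)"
  have C: "finite C" "C \<noteq> {}" using Z finite_components unfolding C_def components_def by auto
  then have "Max (card ` C) \<in> card ` C" by (intro Max_in) auto
  then obtain K1 where K1: "K1 \<in> C" "card K1 = Max (card ` C)" by auto
  have max: "card K \<le> card K1" if "K \<in> C" for K using that C K1 by simp
  have "Z - {z} \<noteq> {}" using Z by blast
  then obtain K2 where K2: "K2 \<in> C" "K2 \<noteq> K1"
    using components_not_conn[of "Z - {z}" K1] Z K1 unfolding C_def by blast
  \<comment> \<open>The largest component serves as the partner, so that \<open>1 + card K1\<close>
    exceeds \<open>card K2\<close> and cancels.\<close>
  have "(1 + card K1) * card (cs K2) \<le> card K2 * P"
    using card_cs_components_le[OF Z(1-3)] K1 K2 unfolding C_def P_def by blast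
  also have "\<dots> \<le> (1 + card K1) * P" using max[OF K2(1)] by (intro mult_le_mono1) simp
  finally have 1: "card (cs K2) \<le> P" by (simp only: mult_le_cancel1)
  have 2: "2 * card (cs K) \<le> card K * P" if "K \<in> C - {K2}" for K
    using card_cs_components_le_half[OF Z(1-3)] that K2 unfolding C_def P_def by blast
  have "card (cs (Z - {z})) = card (cs K2) + (\<Sum>K\<in>C - {K2}. card (cs K))"
    using card_cs_components[of "Z - {z}"] Z C K2 unfolding C_def by (simp add: sum.remove)
  moreover have "2 * (\<Sum>K\<in>C - {K2}. card (cs K)) \<le> (\<Sum>K\<in>C - {K2}. card K) * P"
    unfolding sum_distrib_left sum_distrib_right using 2 by (rule sum_mono)
  moreover have "card (Z - {z}) = card K2 + (\<Sum>K\<in>C - {K2}. card K)"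
    using card_components[of "Z - {z}"] Z C K2 unfolding C_def by (simp add: sum.remove)
  then have "card Z = card K2 + (\<Sum>K\<in>C - {K2}. card K) + 1" using card.remove[of Z z] Z by linarith
  then have "P * (card Z + 3) = card K2 * P + (\<Sum>K\<in>C - {K2}. card K) * P + 4 * P"
    by (simp add: algebra_simps)
  moreover have "card (cs Z) = P + card (cs (Z - {z}))"
    using card_cs_split Z unfolding P_def by blast
  moreover have "l * P \<le> card K2 * P" using l K2 unfolding C_def by simp
  ultimately have "2 * card (cs Z) + l * P \<le> P * (card Z + 3)"
    using 1 by linarith
  then show ?thesis unfolding P_def .
qed

text \<open>The degree conditions force \<open>V\<close> to be a path with end \<open>w\<close>.
  Peeling off \<open>w\<close> makes its neighbour the new end, so that no explicit path is
  needed.\<close>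

lemma card_cs_max_degree_2:
  "finite V \<Longrightarrow> conn V \<Longrightarrow> w \<in> V \<Longrightarrow> (\<And>y. y \<in> V \<Longrightarrow> card (nb V y) \<le> 2) \<Longrightarrow> card (nb V w) \<le> 1 \<Longrightarrow>
    card (cs_above {w} V) \<le> card V \<and> 2 * card (cs V) \<le> card V * (card V + 1)"
proof (induction "card V" arbitrary: V w rule: less_induct)
  case less
  show ?case
  proof (cases "V = {w}")
    case True
    have "cs V \<subseteq> {{w}}" "cs_above {w} V \<subseteq> {{w}}"
      using True conn_nonempty by (auto simp: cs_def cs_above_def)
    then have "card (cs V) \<le> card {{w}}" "card (cs_above {w} V) \<le> card {{w}}"
      by (intro card_mono; simp)+
    then show ?thesis using True by simp
  next
    case False
    have "{w} \<subset> V" using False less.prems by blast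
    then obtain u where u: "u \<in> V - {w}" "E w u"
      by (rule conn_exit[OF less.prems(2)]) auto
    have uniq: "y = u" if "y \<in> V" "E w y" for y
      using less.prems(1,5) u that card_le_Suc0_iff_eq[of "nb V w"] by (auto simp: nb_def)
    define V' where "V' = V - {w}"
    have V': "finite V'" "conn V'" "u \<in> V'" "card V = card V' + 1" "V' \<subseteq> V"
    proof -
      show "conn V'" unfolding V'_def using less.prems False uniq by (intro conn_remove_leaf[of V w u])
      show "card V = card V' + 1" unfolding V'_def using card.remove[of V w] less.prems by linarith
    qed (use less.prems u in \<open>auto simp: V'_def\<close>)
    have nbV': "card (nb V' y) \<le> 2" if "y \<in> V'" for y
      using less.prems(1) less.prems(4)[of y] that V' card_mono[of "nb V y" "nb V' y"]
      by (force simp: nb_def)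
    have "nb V' u \<subset> nb V u" using u sym less.prems by (auto simp: nb_def V'_def)
    then have "card (nb V' u) < card (nb V u)" using less.prems by (intro psubset_card_mono) auto
    then have "card (nb V' u) \<le> 1" using less.prems(4)[of u] u by simp
    then have IH: "card (cs_above {u} V') \<le> card V'" "2 * card (cs V') \<le> card V' * (card V' + 1)"
      using less.hyps[of V' u] V' nbV' by auto
    have "cs_above {w} V \<subseteq> insert {w} (insert w ` cs_above {u} V')"
    proof
      fix U assume "U \<in> cs_above {w} V"
      then have U: "conn U" "U \<subseteq> V" "w \<in> U" by (auto simp: cs_above_def cs_def)
      show "U \<in> insert {w} (insert w ` cs_above {u} V')"
      proof (cases "U = {w}")
        case False
        have "{w} \<subset> U" using False U by blast
        then obtain y where "y \<in> U" "E w y" by (rule conn_exit[OF U(1)]) auto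
        then have "u \<in> U" using uniq U by blast
        moreover have "conn (U - {w})" using conn_remove_leaf[of U w u] U False uniq by blast
        ultimately have "U - {w} \<in> cs_above {u} V'"
          using U u by (auto simp: cs_above_def cs_def V'_def)
        moreover have "U = insert w (U - {w})" using U by blast
        ultimately show ?thesis by blast
      qed simp
    qed
    then have "card (cs_above {w} V) \<le> card (insert {w} (insert w ` cs_above {u} V'))"
      using V' by (intro card_mono) auto
    also have "\<dots> \<le> Suc (card (insert w ` cs_above {u} V'))" by (rule card_insert_le_m1) auto
    also have "\<dots> \<le> card V" using card_image_le[of "cs_above {u} V'" "insert w"] V' IH by simp
    finally have N: "card (cs_above {w} V) \<le> card V" .
    have "card (cs V) = card (cs_above {w} V) + card (cs V')"
      using card_cs_split less.prems unfolding V'_def by blast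
    then show ?thesis using N IH V' by (simp add: algebra_simps)
  qed
qed

section \<open>Parts joined by a single edge\<close>

lemma conn_Int:
  assumes "conn U" "U \<inter> K \<noteq> {}" and w: "\<And>a b. a \<in> U \<inter> K \<Longrightarrow> b \<in> U - K \<Longrightarrow> E a b \<Longrightarrow> a = w"
  shows "conn (U \<inter> K)"
  unfolding conn_def
proof (intro conjI allI impI)
  show "U \<inter> K \<noteq> {}" by fact
next
  fix A assume A: "A \<subseteq> U \<inter> K \<and> A \<noteq> {} \<and> A \<noteq> U \<inter> K"
  show "\<exists>a\<in>A. \<exists>b\<in>U \<inter> K - A. E a b"
  proof (cases "w \<in> A")
    case False
    have "A \<subseteq> U" "A \<noteq> {}" "A \<noteq> U" using A by auto
    then obtain a b where "a \<in> A" "b \<in> U" "b \<notin> A" "E a b" by (rule connD[OF assms(1)])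
    moreover from this have "b \<in> K" using w[of a b] False A by blast
    ultimately show ?thesis by blast
  next
    case True
    let ?B = "U \<inter> K - A"
    have "?B \<subseteq> U" "?B \<noteq> {}" "?B \<noteq> U" using A by auto
    then obtain a b where "a \<in> ?B" "b \<in> U" "b \<notin> ?B" "E a b" by (rule connD[OF assms(1)])
    moreover from this have "b \<in> K" using w[of a b] True by blast
    ultimately show ?thesis using sym by blast
  qed
qed

text \<open>A connected set meeting both sides must use the edge between \<open>w\<close> and
  \<open>x\<close>. Its traces on the two sides are connected, contain \<open>w\<close> and
  \<open>x\<close> respectively, and determine it.\<close>

lemma card_cs_bridge:
  assumes V: "finite V" "K \<subseteq> V"
    and bridge: "\<And>a b. a \<in> K \<Longrightarrow> b \<in> V - K \<Longrightarrow> E a b \<Longrightarrow> a = w \<and> b = x"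
  shows "card (cs V) \<le> card (cs (V - K)) + card (cs K)
           + card (cs_above {x} (V - K)) * card (cs_above {w} K)"
proof -
  let ?X = "cs V - (cs (V - K) \<union> cs K)"
  have fin: "finite K" using V finite_subset by blast
  have "card ?X \<le> card (cs_above {x} (V - K) \<times> cs_above {w} K)"
  proof (rule card_inj_on_le[of "\<lambda>U. (U - K, U \<inter> K)"])
    show "inj_on (\<lambda>U. (U - K, U \<inter> K)) ?X" by (rule inj_onI) blast
    show "(\<lambda>U. (U - K, U \<inter> K)) ` ?X \<subseteq> cs_above {x} (V - K) \<times> cs_above {w} K"
    proof
      fix p assume "p \<in> (\<lambda>U. (U - K, U \<inter> K)) ` ?X"
      then obtain U where U: "p = (U - K, U \<inter> K)" "U \<subseteq> V" "conn U" "U \<inter> K \<noteq> {}" "U - K \<noteq> {}"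
        by (auto simp: cs_def)
      have "U \<inter> K \<subseteq> U" "U \<inter> K \<noteq> U" using U by auto
      then obtain a b where ab: "a \<in> U \<inter> K" "b \<in> U" "b \<notin> U \<inter> K" "E a b"
        using U(4) by (elim connD[OF U(3)]) auto
      have wx: "w \<in> U" "x \<in> U" using bridge[of a b] ab U by auto
      have 1: "conn (U \<inter> K)" using U bridge by (intro conn_Int[of U K w]) auto
      have "conn (U \<inter> - K)" using U bridge sym by (intro conn_Int[of U "- K" x]) blast+
      then have 2: "conn (U - K)" by (simp add: Diff_eq)
      have "w \<in> K" "x \<notin> K" using bridge[of a b] ab U by auto
      then show "p \<in> cs_above {x} (V - K) \<times> cs_above {w} K"
        using 1 2 U wx by (auto simp: cs_above_def cs_def)
    qed
  qed (use V fin in auto)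
  then have X: "card ?X \<le> card (cs_above {x} (V - K)) * card (cs_above {w} K)"
    by (simp add: card_cartesian_product)
  have "card (cs V) \<le> card (?X \<union> (cs (V - K) \<union> cs K))"
    using V fin by (intro card_mono) auto
  also have "\<dots> \<le> card ?X + card (cs (V - K) \<union> cs K)" by (rule card_Un_le)
  also have "card (cs (V - K) \<union> cs K) \<le> card (cs (V - K)) + card (cs K)" by (rule card_Un_le)
  finally show ?thesis using X by linarith
qed

text \<open>Two disjoint families contain \<open>v\<close>: sets containing \<open>x\<close> outside
  \<open>K\<close>, enlarged by all of \<open>K\<close>, and the connected sets inside
  \<open>K\<close>.\<close>

lemma card_cs_above_ge_attached:
  assumes "finite V" "K \<subseteq> V" "conn K" "v \<in> K" "w \<in> K" "x \<in> V - K" "E w x"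
  shows "card (cs_above {x} (V - K)) + card K \<le> card (cs_above {v} V)"
proof -
  have fin: "finite K" using assms finite_subset by blast
  let ?A = "(\<lambda>U. U \<union> K) ` cs_above {x} (V - K)" and ?B = "cs_above {v} K"
  have "card ?A = card (cs_above {x} (V - K))"
    by (rule card_image, rule inj_onI) (auto simp: cs_above_def cs_def)
  moreover have "card K \<le> card ?B" using card_cs_above_ge assms fin by blast
  moreover have "card ?A + card ?B = card (?A \<union> ?B)"
    using assms fin by (intro card_Un_disjoint[symmetric]) (auto simp: cs_above_def cs_def)
  moreover have "conn (U \<union> K)" if "conn U" "x \<in> U" for U
    using that assms sym by (intro conn_Un_edge[of U K x w]) auto
  then have "?A \<union> ?B \<subseteq> cs_above {v} V"
    using assms by (auto simp: cs_above_def cs_def)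
  then have "card (?A \<union> ?B) \<le> card (cs_above {v} V)" using assms by (intro card_mono) auto
  ultimately show ?thesis by linarith
qed

text \<open>If \<open>M - {x}\<close> is connected, the estimate comes from a cut of \<open>M - {x}\<close> at a neighbour of \<open>x\<close>
  instead: each of its pieces contains a component avoiding \<open>x\<close> of \<open>M - {u}\<close> for some neighbour
  \<open>u\<close> of \<open>x\<close>.\<close>

lemma card_cs_branch:
  assumes M: "finite M" "conn M" "x \<in> M" "2 \<le> card (nb M x)"
    and x: "\<And>C. C \<in> components (M - {x}) \<Longrightarrow> \<not> conn (M - {x}) \<Longrightarrow> l \<le> card C"
    and u_cut: "\<And>u. u \<in> nb M x \<Longrightarrow> conn (M - {x}) \<Longrightarrow> \<not> conn (M - {u})"
    and u: "\<And>u C. u \<in> nb M x \<Longrightarrow> conn (M - {x}) \<Longrightarrow> C \<in> components (M - {u}) \<Longrightarrow> x \<notin> C \<Longrightarrow> l \<le> card C"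
  shows "2 * card (cs M) + l * card (cs_above {x} M) \<le> card (cs_above {x} M) * (card M + 4)"
proof (cases "conn (M - {x})")
  case False
  have "nb M x \<noteq> {}" using M(4) by auto
  then have "M \<noteq> {x}" using irrefl unfolding nb_def by auto
  then have "2 * card (cs M) + l * card (cs_above {x} M) \<le> card (cs_above {x} M) * (card M + 3)"
    using card_cs_cut[of M x l] M x False by blast
  also have "\<dots> \<le> card (cs_above {x} M) * (card M + 4)" by simp
  finally show ?thesis .
next
  case True
  define Z where "Z = M - {x}"
  obtain u1 u2 where u12: "u1 \<in> nb M x" "u2 \<in> nb M x" "u1 \<noteq> u2" using card_ge_2D[OF M(4)] .
  have nbZ: "v \<in> Z" "E x v" if "v \<in> nb M x" for v using that irrefl unfolding nb_def Z_def by auto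
  have Z: "finite Z" "conn Z" "u1 \<in> Z" "Z \<noteq> {u1}" "card M = card Z + 1" "x \<notin> Z"
  proof -
    show "Z \<noteq> {u1}" using nbZ(1)[OF u12(2)] u12(3) by blast
    show "card M = card Z + 1" unfolding Z_def using card.remove[of M x] M by linarith
  qed (use M True nbZ u12 in \<open>auto simp: Z_def\<close>)
  \<comment> \<open>\<open>u1\<close> cuts \<open>M\<close>, and putting \<open>x\<close> back could
    not repair a connected \<open>Z - {u1}\<close> wrongly: \<open>x\<close> remains attached to it
    through \<open>u2\<close>.\<close>
  have cut: "\<not> conn (Z - {u1})"
  proof
    assume "conn (Z - {u1})"
    then have "conn (insert x (Z - {u1}))"
      by (rule conn_insert[of _ u2]) (use u12 nbZ in auto)
    moreover have "insert x (Z - {u1}) = M - {u1}" using M Z unfolding Z_def by auto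
    ultimately show False using u_cut[OF u12(1) True] by simp
  qed
  have l: "l \<le> card C" if C: "C \<in> components (Z - {u1})" for C
  proof (cases "C \<inter> nb M x = {}")
    case True': True
    have CZ: "C \<subseteq> Z - {u1}" using components_subset C by blast
    have "C \<in> components (M - {u1})"
    proof (rule components_I)
      show "C \<subseteq> M - {u1}" using CZ unfolding Z_def by blast
      show "conn C" using components_conn C by blast
      fix a b assume ab: "a \<in> C" "b \<in> M - {u1} - C"
      show "\<not> E a b"
      proof (cases "b = x")
        case True
        have "a \<in> M" using ab CZ unfolding Z_def by blast
        then show ?thesis using True ab True' sym unfolding nb_def by blast
      next
        case False
        then show ?thesis using components_no_edge[OF C ab(1), of b] ab unfolding Z_def by blast
      qed
    qed
    then show ?thesis using u[OF u12(1) True] CZ Z by blast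
  next
    case False
    then obtain v where v: "v \<in> C" "v \<in> nb M x" by blast
    have CZ: "C \<subseteq> Z - {u1}" using components_subset C by blast
    have xv: "x \<in> M - {v}" using M nbZ v Z by auto
    have u1v: "u1 \<in> M - {v}" using u12 v CZ unfolding nb_def by auto
    define X where "X = component (M - {v}) x"
    have X: "X \<in> components (M - {v})" "x \<in> X"
      using xv component_self unfolding X_def components_def by auto
    have "M - {v} \<noteq> {}" using xv by blast
    then obtain C' where C': "C' \<in> components (M - {v})" "C' \<noteq> X"
      using components_not_conn[OF _ u_cut[OF v(2) True] X(1)] by blast
    have disj: "C' \<inter> X = {}" using components_disjoint C' X by blast
    \<comment> \<open>\<open>x\<close> and \<open>u1\<close> are adjacent and both survive the
      removal of \<open>v\<close>. Hence \<open>C'\<close> avoids both, and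
      \<open>insert v C'\<close> fits into the piece \<open>C\<close>.\<close>
    have "{x, u1} \<subseteq> X"
      using xv u1v X u12 nbZ conn_edge by (intro components_max[OF X(1)]) auto
    then have nC': "x \<notin> C'" "u1 \<notin> C'" using disj by auto
    have lC': "l \<le> card C'" using u[OF v(2) True C'(1) nC'(1)] .
    have vM: "v \<in> M" using v unfolding nb_def by blast
    obtain y where y: "y \<in> C'" "E v y" using components_adj[OF M(2) vM C'(1)] .
    have "conn (insert v C')" using conn_insert y components_conn C' by blast
    moreover have "insert v C' \<subseteq> Z - {u1}"
      using nC' components_subset[OF C'(1)] v CZ unfolding Z_def by auto
    ultimately have "insert v C' \<subseteq> C" using v by (intro components_max[OF C]) auto
    moreover have "finite C" using CZ Z finite_subset by blast
    ultimately have "card C' \<le> card C" by (intro card_mono) auto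
    then show ?thesis using lC' by linarith
  qed
  define P where "P = card (cs_above {u1} Z)"
  define R where "R = card (cs_above {x} M)"
  have T: "2 * card (cs Z) + l * P \<le> P * (card Z + 3)"
    unfolding P_def using card_cs_cut[of Z u1 l] Z cut l by blast
  have PR: "P \<le> R" unfolding P_def R_def
    using card_cs_above_neighbour[of M x Z u1] M Z nbZ u12 unfolding Z_def by blast
  have "u2 \<in> Z - {u1}" using u12 nbZ by auto
  then have C0: "component (Z - {u1}) u2 \<in> components (Z - {u1})" unfolding components_def by blast
  have "card (component (Z - {u1}) u2) \<le> card Z"
    using component_subset Z by (intro card_mono) auto
  \<comment> \<open>In \<open>T\<close> the quantity \<open>P\<close> occurs on both sides. Only
    with a natural difference \<open>d\<close> on the right can \<open>P\<close> be replaced by the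
    larger \<open>R\<close>.\<close>
  then have "l \<le> card Z + 3" using l[OF C0] by linarith
  then obtain d where d: "card Z + 3 = l + d" using le_Suc_ex by blast
  have "2 * card (cs Z) \<le> P * d" using T unfolding d by (simp add: algebra_simps)
  also have "\<dots> \<le> R * d" using PR by simp
  finally have 1: "2 * card (cs Z) \<le> R * d" .
  have "card (cs M) = R + card (cs Z)" using card_cs_split M unfolding R_def Z_def by blast
  then have "2 * card (cs M) + l * R \<le> R * (l + d) + 2 * R" using 1 by (simp add: algebra_simps)
  also have "\<dots> = R * (card M + 4)" unfolding d[symmetric] using Z by (simp add: algebra_simps)
  finally show ?thesis unfolding R_def .
qed

section \<open>A noncut vertex in many connected sets\<close>

text \<open>A noncut vertex with two neighbours will do by \<open>card_cs_Diff_noncut\<close>, so suppose that noncut vertices have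
  degree at most 1. Choose a vertex \<open>x\<close> of degree at least 3 and a component \<open>K\<close> of its complement
  with \<open>K\<close> as small as possible. Minimality makes \<open>K\<close> a pendant path attached to \<open>x\<close>, and its
  far end \<open>v\<close> will do: every other branch of the graph has at least as many vertices as \<open>K\<close>.\<close>

lemma ex_good_noncut:
  assumes V: "finite V" "conn V" "2 \<le> card V"
  shows "\<exists>v\<in>V. conn (V - {v}) \<and>
    2 * card (cs (V - {v})) \<le> (card V + 3) * card (cs_above {v} V)"
proof (rule ccontr)
  assume neg: "\<not> ?thesis"
  have noncut: "card (nb V v) \<le> 1" if "v \<in> V" "conn (V - {v})" for v
  proof (rule ccontr)
    assume "\<not> card (nb V v) \<le> 1"
    then have "2 * card (cs (V - {v})) \<le> card V * card (cs_above {v} V)"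
      using V that by (intro card_cs_Diff_noncut) auto
    also have "\<dots> \<le> (card V + 3) * card (cs_above {v} V)" by (rule mult_le_mono1) simp
    finally show False using neg that by blast
  qed
  show False
  proof (cases "\<forall>y\<in>V. card (nb V y) \<le> 2")
    case True
    obtain y where "y \<in> V" using conn_nonempty V by blast
    moreover have "V \<noteq> {y}" using V by auto
    ultimately have "{y} \<subset> V" by blast
    then obtain v where v: "v \<in> V" "conn (V - {v})"
      by (rule ex_noncut[OF V(1,2) conn_singleton]) blast
    \<comment> \<open>\<open>V\<close> is a path here: in a cycle every vertex would be noncut with
      two neighbours.\<close>
    have "2 * card (cs V) \<le> card V * (card V + 1)"
      using card_cs_max_degree_2[of V v] V True v noncut[OF v] by blast
    moreover have "card (cs (V - {v})) \<le> card (cs V)"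
      using V by (intro card_mono) (auto simp: cs_def)
    ultimately have "2 * card (cs (V - {v})) \<le> (card V + 1) * card V" by (simp add: mult.commute)
    also have "\<dots> \<le> (card V + 3) * card (cs_above {v} V)"
      using V v by (intro mult_le_mono card_cs_above_ge) auto
    finally show False using neg v by blast
  next
    case False
    define P where "P = (\<lambda>(x, K). x \<in> V \<and> 3 \<le> card (nb V x) \<and> K \<in> components (V - {x}))"
    have "\<exists>p. P p"
    proof -
      obtain x where x: "x \<in> V" "3 \<le> card (nb V x)" using False by force
      then have "nb V x \<noteq> {}" by auto
      then obtain y where "y \<in> V - {x}" using irrefl unfolding nb_def by blast
      then have "P (x, component (V - {x}) y)" using x unfolding P_def components_def by blast
      then show ?thesis by blast
    qed
    then obtain p where p: "P p" "\<And>q. P q \<Longrightarrow> card (snd p) \<le> card (snd q)"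
      using ex_has_least_nat[of P _ "\<lambda>p. card (snd p)"] by blast
    obtain x K where xK: "p = (x, K)" by (cases p)
    have x: "x \<in> V" "3 \<le> card (nb V x)" and K: "K \<in> components (V - {x})"
      using p(1) unfolding xK P_def by auto
    have min: "card K \<le> card C"
      if "y \<in> V" "3 \<le> card (nb V y)" "C \<in> components (V - {y})" for y C
      using p(2)[of "(y, C)"] that unfolding xK P_def by simp
    have cK: "conn K" using components_conn K by blast
    have KV: "K \<subseteq> V - {x}" using components_subset K by blast
    have finK: "finite K" using KV V by (meson finite_Diff finite_subset)
    define M where "M = V - K"
    have M: "conn M" "x \<in> M" "finite M" "M \<subseteq> V" "K \<union> M = V" "K \<inter> M = {}"
      using conn_Diff_component[OF V(2) x(1) K] x KV V unfolding M_def by auto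
    have edge: "b = x" if "a \<in> K" "b \<in> M" "E a b" for a b
      using components_no_edge[OF K, of a b] that unfolding M_def by blast
    \<comment> \<open>Otherwise \<open>y\<close> is a cut vertex. The connected \<open>M\<close>
      stays in one component of \<open>V - {y}\<close>, so another one lies properly inside
      \<open>K\<close>, against minimality.\<close>
    have deg_K: "card (nb V y) \<le> 2" if y: "y \<in> K" for y
    proof (rule ccontr)
      assume deg: "\<not> card (nb V y) \<le> 2"
      have yV: "y \<in> V" using y KV by blast
      have ncut: "\<not> conn (V - {y})" using noncut[OF yV] deg by auto
      have xy: "x \<in> V - {y}" using x y KV by auto
      define X where "X = component (V - {y}) x"
      have X: "X \<in> components (V - {y})" "x \<in> X"
        using xy component_self unfolding X_def components_def by auto
      have MX: "M \<subseteq> X" using M X y by (intro components_max[OF X(1)]) auto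
      have "V - {y} \<noteq> {}" using xy by blast
      then obtain C where C: "C \<in> components (V - {y})" "C \<noteq> X"
        using components_not_conn[OF _ ncut X(1)] by blast
      have "C \<inter> X = {}" using components_disjoint C X by blast
      then have "C \<subset> K" using components_subset[OF C(1)] MX M y by blast
      then have "card C < card K" using finK psubset_card_mono by blast
      then show False using min[OF yV _ C(1)] deg by simp
    qed
    obtain w where w: "w \<in> K" "E x w" using components_adj[OF V(2) x(1) K] .
    have deg_w: "card (nb K w) \<le> 1"
    proof -
      have "nb K w \<subset> nb V w" using x w sym KV unfolding nb_def by blast
      then have "card (nb K w) < card (nb V w)" using V by (intro psubset_card_mono) auto
      then show ?thesis using deg_K[OF w(1)] by simp
    qed
    \<comment> \<open>With a second neighbour \<open>w'\<close> of \<open>x\<close> in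
      \<open>K\<close>, removing the path end \<open>w\<close> would keep \<open>V\<close>
      connected, though \<open>w\<close> has the two neighbours \<open>x\<close> and
      \<open>u\<close>.\<close>
    have uniq: "w' = w" if w': "w' \<in> K" "E x w'" for w'
    proof (rule ccontr)
      assume ne: "w' \<noteq> w"
      then have "{w} \<subset> K" using w w' by blast
      then obtain u where u: "u \<in> K - {w}" "E w u" by (rule conn_exit[OF cK]) auto
      have "y = u" if "y \<in> K" "E w y" for y
        using deg_w u that finK card_le_Suc0_iff_eq[of "nb K w"] unfolding nb_def by auto
      then have "conn (K - {w})" using ne w w' cK by (intro conn_remove_leaf[of K w u]) auto
      then have "conn ((K - {w}) \<union> M)"
        by (rule conn_Un_edge[of _ M w' x]) (use M w' ne sym in auto)
      moreover have "(K - {w}) \<union> M = V - {w}" using M w by blast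
      ultimately have "card (nb V w) \<le> 1" using noncut[of w] w KV by auto
      moreover have "{x, u} \<subseteq> nb V w" using x w u sym KV unfolding nb_def by blast
      then have "card {x, u} \<le> card (nb V w)" using V by (intro card_mono) auto
      moreover have "x \<noteq> u" using u KV by blast
      ultimately show False by simp
    qed
    have legK: "card (cs_above {w} K) \<le> card K" "2 * card (cs K) \<le> card K * (card K + 1)"
    proof -
      have "card (nb K y) \<le> 2" if "y \<in> K" for y
      proof -
        have "card (nb K y) \<le> card (nb V y)" using V KV by (intro card_mono) (auto simp: nb_def)
        then show ?thesis using deg_K[OF that] by linarith
      qed
      then show "card (cs_above {w} K) \<le> card K" "2 * card (cs K) \<le> card K * (card K + 1)"
        using card_cs_max_degree_2[OF finK cK w(1) _ deg_w] by auto
    qed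
    \<comment> \<open>The far end of the path is found without describing the path: some vertex
      outside the connected set \<open>M\<close> is noncut.\<close>
    have "M \<subset> V" using M w by blast
    then obtain v where v: "v \<in> V - M" "conn (V - {v})" by (rule ex_noncut[OF V(1,2) M(1)])
    then have vK: "v \<in> K" "v \<in> V" using M by auto
    define R where "R = card (cs_above {x} M)"
    define N where "N = card (cs_above {v} V)"
    have N: "R + card K \<le> N"
      unfolding R_def N_def M_def
      by (rule card_cs_above_ge_attached[of V K v w x]) (use V KV cK vK w x sym in auto)
    have bridge: "card (cs V) \<le> card (cs M) + card (cs K) + R * card (cs_above {w} K)"
      unfolding R_def M_def
    proof (rule card_cs_bridge)
      fix a b assume "a \<in> K" "b \<in> V - K" "E a b"
      then show "a = w \<and> b = x" using edge[of a b] uniq[of a] sym unfolding M_def by blast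
    qed (use V KV in auto)
    have deg_M: "2 \<le> card (nb M x)"
    proof -
      have "nb V x \<subseteq> insert w (nb M x)" using uniq M unfolding nb_def by blast
      then have "card (nb V x) \<le> card (insert w (nb M x))" using M by (intro card_mono) auto
      also have "\<dots> \<le> Suc (card (nb M x))" by (rule card_insert_le_m1) auto
      finally show ?thesis using x by simp
    qed
    \<comment> \<open>Otherwise \<open>u\<close> would be noncut in \<open>V\<close> as well,
      because \<open>K\<close> hangs on \<open>x\<close>; but \<open>u\<close> has a second
      neighbour in the connected \<open>M - {x}\<close>.\<close>
    have cutM: "\<not> conn (M - {u})" if u: "u \<in> nb M x" "conn (M - {x})" for u
    proof
      assume cu: "conn (M - {u})"
      have uM: "u \<in> M - {x}" "E x u" using u irrefl unfolding nb_def by auto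
      have "conn ((M - {u}) \<union> K)"
        by (rule conn_Un_edge[OF cu cK, of x w]) (use M w uM in auto)
      moreover have "(M - {u}) \<union> K = V - {u}" using M uM by blast
      ultimately have c1: "card (nb V u) \<le> 1" using noncut[of u] uM M by auto
      obtain a b where ab: "a \<in> nb M x" "b \<in> nb M x" "a \<noteq> b" using card_ge_2D[OF deg_M] .
      then have "a \<in> M - {x}" "b \<in> M - {x}" using irrefl unfolding nb_def by auto
      then have "M - {x} \<noteq> {u}" using ab(3) by (metis singletonD)
      then have "{u} \<subset> M - {x}" using uM(1) by auto
      then obtain y where y: "y \<in> M - {x}" "E u y" by (rule conn_exit[OF u(2)]) auto
      have "{x, y} \<subseteq> nb V u" using x y uM M sym unfolding nb_def by blast
      then have "card {x, y} \<le> card (nb V u)" using V by (intro card_mono) auto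
      moreover have "x \<noteq> y" using y by blast
      ultimately show False using c1 by simp
    qed
    have "2 * card (cs M) + card K * R \<le> R * (card M + 4)"
      unfolding R_def
    proof (rule card_cs_branch[OF M(3,1,2) deg_M])
      fix C assume C: "C \<in> components (M - {x})"
      have "C \<in> components (V - {x})"
      proof (rule components_I)
        show "C \<subseteq> V - {x}" using components_subset[OF C] M by blast
        show "conn C" using components_conn C by blast
        fix a b assume ab: "a \<in> C" "b \<in> V - {x} - C"
        have a: "a \<in> M" "a \<noteq> x" using ab components_subset[OF C] by auto
        show "\<not> E a b"
        proof (cases "b \<in> K")
          case True
          then show ?thesis using edge[of b a] a sym by blast
        next
          case False
          then have "b \<in> M - {x} - C" using ab M by blast
          then show ?thesis using components_no_edge[OF C ab(1)] by blast
        qed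
      qed
      then show "card K \<le> card C" using min x by blast
    next
      show "\<not> conn (M - {u})" if "u \<in> nb M x" "conn (M - {x})" for u
        using cutM that .
    next
      fix u C assume u: "u \<in> nb M x" "conn (M - {x})" and C: "C \<in> components (M - {u})" "x \<notin> C"
      have uM: "u \<in> M - {x}" "E x u" using u irrefl unfolding nb_def by auto
      have "C \<in> components (V - {u})"
      proof (rule components_I)
        show "C \<subseteq> V - {u}" using components_subset[OF C(1)] M by blast
        show "conn C" using components_conn C by blast
        fix a b assume ab: "a \<in> C" "b \<in> V - {u} - C"
        have a: "a \<in> M" "a \<noteq> x" using ab components_subset[OF C(1)] C by auto
        show "\<not> E a b"
        proof (cases "b \<in> K")
          case True
          then show ?thesis using edge[of b a] a sym by blast
        next
          case False
          then have "b \<in> M - {u} - C" using ab M by blast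
          then show ?thesis using components_no_edge[OF C(1) ab(1)] by blast
        qed
      qed
      \<comment> \<open>Needed to compare \<open>C\<close> with the minimal \<open>K\<close>:
        \<open>u\<close> also cuts \<open>M - {x}\<close>, so it has neighbours in two components
        there, besides \<open>x\<close>.\<close>
      moreover have "3 \<le> card (nb V u)"
      proof -
        obtain a b where "a \<in> nb M x" "b \<in> nb M x" "a \<noteq> b" using card_ge_2D[OF deg_M] .
        then obtain u' where u': "u' \<in> nb M x" "u' \<noteq> u" by metis
        have u'M: "u' \<in> M - {x} - {u}" "E x u'" using u' irrefl unfolding nb_def by auto
        have ncut: "\<not> conn (M - {x} - {u})"
        proof
          assume "conn (M - {x} - {u})"
          then have "conn (insert x (M - {x} - {u}))"
            by (rule conn_insert[of _ u']) (use u'M in auto)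
          moreover have "insert x (M - {x} - {u}) = M - {u}" using M uM by blast
          ultimately show False using cutM[OF u] by simp
        qed
        define X where "X = component (M - {x} - {u}) u'"
        have X: "X \<in> components (M - {x} - {u})"
          using u'M unfolding X_def components_def by blast
        have "M - {x} - {u} \<noteq> {}" using u'M by blast
        then obtain Y where Y: "Y \<in> components (M - {x} - {u})" "Y \<noteq> X"
          using components_not_conn[OF _ ncut X] by blast
        obtain y where y: "y \<in> X" "E u y" using components_adj[OF u(2) uM(1) X] .
        obtain z where z: "z \<in> Y" "E u z" using components_adj[OF u(2) uM(1) Y(1)] .
        have yz: "y \<in> M" "y \<noteq> x" "z \<in> M" "z \<noteq> x"
          using y z components_subset[OF X] components_subset[OF Y(1)] by auto
        have "y \<noteq> z" using components_disjoint[OF X Y(1)] Y y z by blast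
        then have "card {x, y, z} = 3" using yz by simp
        moreover have "{x, y, z} \<subseteq> nb V u" using x y z yz uM M sym unfolding nb_def by blast
        then have "card {x, y, z} \<le> card (nb V u)" using V by (intro card_mono) auto
        ultimately show ?thesis by simp
      qed
      moreover have "u \<in> V" using uM M by blast
      ultimately show "card K \<le> card C" using min by blast
    qed
    moreover have "R * card (cs_above {w} K) \<le> R * card K" using legK by simp
    \<comment> \<open>Doubled, the sets across the bridge cost \<open>2 * R * card K\<close>, half
      of which the gain in the branch estimate returns. The factor \<open>card V + 5\<close> for all
      connected sets becomes \<open>card V + 3\<close> once those containing \<open>v\<close> are
      taken off.\<close>
    moreover have "R * (card M + 4) + card K * R + card K * (card K + 1)
        \<le> (card M + card K + 5) * (R + card K)"
      by (simp add: algebra_simps)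
    moreover have "\<dots> \<le> (card M + card K + 5) * N" using N by simp
    moreover have "card (cs V) = N + card (cs (V - {v}))"
      using card_cs_split V unfolding N_def by blast
    moreover have "(card M + card K + 5) * N = (card M + card K + 3) * N + 2 * N"
      by (simp add: algebra_simps)
    moreover have "R * card K = card K * R" by (rule mult.commute)
    ultimately have "2 * card (cs (V - {v})) \<le> (card M + card K + 3) * N"
      using bridge legK(2) by linarith
    moreover have "card V = card M + card K"
      using card_Un_disjoint[of K M] M finK by simp
    ultimately show False using neg vK v unfolding N_def by auto
  qed
qed

section \<open>The density bound\<close>

lemma card_mult_cs_above_le:
  assumes "finite V" "conn V" "v \<in> V"
  shows "(card V + 1) * card (cs_above {v} V) \<le> 2 * (\<Sum>U\<in>cs_above {v} V. card U)"
proof -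
  have "0 \<le> (\<Sum>U\<in>cs_above {v} V. 2 * int (card U) - int (card V) - int (card {v}))"
    using assms by (intro sum_cs_above_ge) auto
  also have "\<dots> = 2 * int (\<Sum>U\<in>cs_above {v} V. card U) - int (card (cs_above {v} V)) * (int (card V) + 1)"
    by (simp add: sum_subtractf sum_distrib_left algebra_simps)
  finally have "int ((card V + 1) * card (cs_above {v} V)) \<le> int (2 * (\<Sum>U\<in>cs_above {v} V. card U))"
    by (simp add: algebra_simps)
  then show ?thesis by (simp only: of_nat_le_iff)
qed

lemma sum_card_cs_split:
  "finite V \<Longrightarrow> (\<Sum>U\<in>cs V. card U) = (\<Sum>U\<in>cs_above {v} V. card U) + (\<Sum>U\<in>cs (V - {v}). card U)"
  by (subst cs_split(1)[of V v], rule sum.union_disjoint) (simp_all add: cs_split(2))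

lemma sum_card_cs_ge_third:
  "finite V \<Longrightarrow> conn V \<Longrightarrow> card V * card (cs V) \<le> 3 * (\<Sum>U\<in>cs V. card U)"
proof (induction "card V" arbitrary: V rule: less_induct)
  case less
  show ?case
  proof (cases "2 \<le> card V")
    case False
    have "card V \<noteq> 0" using less.prems conn_nonempty by auto
    then have V1: "card V = 1" using False by linarith
    have "1 \<le> card U" if "U \<in> cs V" for U
    proof -
      have "finite U" "U \<noteq> {}" using that less.prems(1) conn_nonempty finite_subset
        unfolding cs_def by blast+
      then show ?thesis by (simp add: Suc_le_eq card_gt_0_iff)
    qed
    then have "(\<Sum>U\<in>cs V. 1) \<le> (\<Sum>U\<in>cs V. card U)" by (rule sum_mono)
    then show ?thesis using V1 by simp
  next
    case True
    then obtain v where v: "v \<in> V" "conn (V - {v})"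
      "2 * card (cs (V - {v})) \<le> (card V + 3) * card (cs_above {v} V)"
      using ex_good_noncut less.prems by blast
    define m where "m = card (V - {v})"
    have n: "card V = m + 1" unfolding m_def using card.remove[of V v] less.prems v by linarith
    have IH: "m * card (cs (V - {v})) \<le> 3 * (\<Sum>U\<in>cs (V - {v}). card U)"
    proof -
      have "card (V - {v}) < card V" using n unfolding m_def by linarith
      then show ?thesis
        using less.hyps[of "V - {v}"] v(2) less.prems(1) unfolding m_def by blast
    qed
    have "(m + 2) * card (cs_above {v} V) \<le> 2 * (\<Sum>U\<in>cs_above {v} V. card U)"
      using card_mult_cs_above_le[OF less.prems v(1)] n by simp
    \<comment> \<open>Here \<open>n + 3\<close> arises: \<open>IH\<close> covers \<open>m\<close>
      times the number of sets avoiding \<open>v\<close>, and the average size covers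
      \<open>3 / 2 * (m + 2)\<close> times the number containing \<open>v\<close>. Of the goal this
      leaves (sets avoiding \<open>v\<close>) \<le> \<open>(m + 4) / 2\<close> (sets containing
      \<open>v\<close>), with \<open>m + 4 = n + 3\<close>.\<close>
    then show ?thesis
      using IH v(3) unfolding sum_card_cs_split[OF less.prems(1), of v]
        card_cs_split[OF less.prems(1), of v] n by (simp add: algebra_simps)
  qed
qed

text \<open>Double counting of incidences; the largest summand on the left is then at least the
  total size divided by \<open>card V\<close>.\<close>

lemma sum_card_cs_above:
  assumes "finite V"
  shows "(\<Sum>v\<in>V. card (cs_above {v} V)) = (\<Sum>U\<in>cs V. card U)"
proof -
  have "(\<Sum>v\<in>V. card {U \<in> cs V. v \<in> U}) = (\<Sum>U\<in>cs V. card U)"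
  proof (rule sum_multicount_gen)
    show "\<forall>U\<in>cs V. card {v \<in> V. v \<in> U} = card U"
    proof
      fix U assume "U \<in> cs V"
      then have "{v \<in> V. v \<in> U} = U" unfolding cs_def by blast
      then show "card {v \<in> V. v \<in> U} = card U" by simp
    qed
  qed (use assms in auto)
  then show ?thesis by (simp add: cs_above_def)
qed

section \<open>Induction on the connectivity\<close>

definition k_conn :: "nat \<Rightarrow> 'a set \<Rightarrow> bool" where
  "k_conn k V \<longleftrightarrow> k < card V \<and> (\<forall>X. X \<subseteq> V \<and> card X < k \<longrightarrow> conn (V - X))"

lemma k_conn_conn: "k_conn (Suc j) V \<Longrightarrow> conn V"
  unfolding k_conn_def by (metis Diff_empty card.empty empty_subsetI zero_less_Suc)

lemma k_conn_remove:
  assumes "finite V" "k_conn (Suc k) V" "v \<in> V"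
  shows "k_conn k (V - {v})"
  unfolding k_conn_def
proof (intro conjI allI impI)
  show "k < card (V - {v})" using assms card.remove[of V v] unfolding k_conn_def by linarith
  fix X assume X: "X \<subseteq> V - {v} \<and> card X < k"
  have "card (insert v X) \<le> Suc (card X)" by (rule card_insert_le_m1) auto
  then have "card (insert v X) < Suc k" using X by linarith
  moreover have "insert v X \<subseteq> V" using X assms(3) by blast
  ultimately have "conn (V - insert v X)" using assms(2) unfolding k_conn_def by blast
  moreover have "V - insert v X = V - {v} - X" by blast
  ultimately show "conn (V - {v} - X)" by simp
qed

text \<open>With \<open>D\<close> the density, the vertex \<open>v\<close> contained in the most connected sets lies in a fraction
  of at least \<open>D\<close> of them. If \<open>d\<close> bounds the density of \<open>V - {v}\<close>, splitting at \<open>v\<close> yields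
  \<open>D \<ge> d / (1 / 2 + d)\<close>, and this recursion is solved exactly by \<open>d = 2 ^ j / (2 * 2 ^ j + 1)\<close>.\<close>

lemma sum_card_cs_ge:
  "finite V \<Longrightarrow> k_conn (Suc j) V \<Longrightarrow>
    2 ^ j * card V * card (cs V) \<le> (2 * 2 ^ j + 1) * (\<Sum>U\<in>cs V. card U)"
proof (induction j arbitrary: V)
  case 0
  then show ?case using sum_card_cs_ge_third[of V] k_conn_conn[of 0 V] by simp
next
  case (Suc j)
  define S where "S = (\<Sum>U\<in>cs V. card U)"
  define f where "f = (\<lambda>v. card (cs_above {v} V))"
  have V: "conn V" "V \<noteq> {}" using Suc.prems k_conn_conn conn_nonempty by blast+
  have "Max (f ` V) \<in> f ` V" using V Suc.prems by (intro Max_in) auto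
  then obtain v where v: "v \<in> V" "f v = Max (f ` V)" by auto
  define m where "m = card (V - {v})"
  have n: "card V = m + 1" unfolding m_def using card.remove[of V v] Suc.prems v by linarith
  have m: "0 < m" using n Suc.prems unfolding k_conn_def by linarith
  have max: "S \<le> (m + 1) * f v"
    using sum_bounded_above[of V f "f v"] v Suc.prems sum_card_cs_above[of V]
    unfolding S_def n[symmetric] by (simp add: f_def)
  define q :: nat where "q = 2 ^ Suc j"
  define N' where "N' = card (cs (V - {v}))"
  define S' where "S' = (\<Sum>U\<in>cs (V - {v}). card U)"
  define Sv where "Sv = (\<Sum>U\<in>cs_above {v} V. card U)"
  have "2 ^ j * m * N' \<le> (2 * 2 ^ j + 1) * S'"
    unfolding m_def N'_def S'_def using Suc.prems v by (intro Suc.IH k_conn_remove) auto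
  then have IH: "q * m * N' \<le> 2 * (q + 1) * S'" unfolding q_def by (simp add: algebra_simps)
  have Sv: "(m + 2) * f v \<le> 2 * Sv"
    unfolding f_def Sv_def using card_mult_cs_above_le[of V v] Suc.prems V v n by simp
  have S: "S = Sv + S'" unfolding S_def Sv_def S'_def using sum_card_cs_split Suc.prems by blast
  have N: "card (cs V) = f v + N'" unfolding f_def N'_def using card_cs_split Suc.prems by blast
  have "(q + 1) * ((m + 2) * f v) \<le> (q + 1) * (2 * Sv)" using Sv by (rule mult_le_mono2)
  then have 1: "(m + 2 + 2 * q) * f v + q * m * card (cs V) \<le> 2 * (q + 1) * S"
    using IH unfolding S N by (simp add: algebra_simps)
  have "(m + 2 + 2 * q) * S \<le> (m + 2 + 2 * q) * ((m + 1) * f v)" using max by (rule mult_le_mono2)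
  moreover have "(m + 1) * ((m + 2 + 2 * q) * f v + q * m * card (cs V)) \<le> (m + 1) * (2 * (q + 1) * S)"
    using 1 by (rule mult_le_mono2)
  \<comment> \<open>The coefficient of \<open>S\<close> is
    \<open>2 * (m + 1) * (q + 1) - (m + 2 + 2 * q) = m * (2 * q + 1)\<close>. The average
    \<open>(m + 2) / 2\<close>, rather than \<open>(m + 1) / 2\<close>, is what lets
    \<open>m\<close> cancel and makes the recursion independent of the order.\<close>
  ultimately have "m * (q * card V * card (cs V)) \<le> m * ((2 * q + 1) * S)"
    unfolding n by (simp add: algebra_simps)
  then have "q * card V * card (cs V) \<le> (2 * q + 1) * S" using m by simp
  then show ?case unfolding q_def S_def .
qed

end

lemma connected_induce_subgraph_iff:
  assumes "graph G" "U \<subseteq> verts G"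
  shows "Digraph_Component.connected (G \<restriction> U) \<longleftrightarrow> sgraph_rel.conn (\<lambda>u v. u \<rightarrow>\<^bsub>G\<^esub> v) U"
proof -
  interpret graph G by fact
  interpret R: sgraph_rel "\<lambda>u v. u \<rightarrow>\<^bsub>G\<^esub> v"
    using arcs_ends_symmetric[OF sym_arcs] adj_not_same by unfold_locales auto
  interpret H: wf_digraph "G \<restriction> U" by (rule wellformed_induce_subgraph)
  have sym: "symmetric (G \<restriction> U)"
    using induced_graph_imp_symmetric[OF sym_arcs] induced_induce assms(2) by blast
  have adj: "a \<rightarrow>\<^bsub>G \<restriction> U\<^esub> b \<longleftrightarrow> a \<in> U \<and> b \<in> U \<and> a \<rightarrow>\<^bsub>G\<^esub> b" for a b
    by (auto simp: arcs_ends_conv)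
  \<comment> \<open>The library asks for reachability in the symmetric closure; the induced arcs are
    already symmetric. Cuts enter because the set reachable from a vertex has no leaving
    edge.\<close>
  have "Digraph_Component.connected (G \<restriction> U) \<longleftrightarrow>
      U \<noteq> {} \<and> (\<forall>u\<in>U. \<forall>v\<in>U. u \<rightarrow>\<^sup>*\<^bsub>G \<restriction> U\<^esub> v)"
    unfolding Digraph_Component.connected_def strongly_connected_def
    using H.reachable_mk_symmetric_eq[OF sym] by simp
  also have "\<dots> \<longleftrightarrow> R.conn U"
  proof (intro iffI conjI ballI)
    assume h: "U \<noteq> {} \<and> (\<forall>u\<in>U. \<forall>v\<in>U. u \<rightarrow>\<^sup>*\<^bsub>G \<restriction> U\<^esub> v)"
    show "R.conn U"
      unfolding R.conn_def
    proof (intro conjI allI impI)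
      show "U \<noteq> {}" using h by blast
    next
      fix A assume A: "A \<subseteq> U \<and> A \<noteq> {} \<and> A \<noteq> U"
      show "\<exists>a\<in>A. \<exists>b\<in>U - A. a \<rightarrow>\<^bsub>G\<^esub> b"
      proof (rule ccontr)
        assume no: "\<not> ?thesis"
        obtain a b where ab: "a \<in> A" "b \<in> U" "b \<notin> A" using A by blast
        then have "a \<rightarrow>\<^sup>*\<^bsub>G \<restriction> U\<^esub> b" using h A by blast
        then have "b \<in> A"
        proof (induction rule: H.reachable_induct)
          case base
          show ?case by fact
        next
          case (step y z)
          then show ?case using no adj by blast
        qed
        then show False using ab by blast
      qed
    qed
  next
    assume "R.conn U"
    then show "U \<noteq> {}" by (rule R.conn_nonempty)
  next
    fix u v assume c: "R.conn U" and u: "u \<in> U" and v: "v \<in> U"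
    let ?A = "{w \<in> U. u \<rightarrow>\<^sup>*\<^bsub>G \<restriction> U\<^esub> w}"
    have "u \<in> ?A" using u by auto
    have "?A = U"
    proof (rule ccontr)
      assume "?A \<noteq> U"
      then obtain a b where "a \<in> ?A" "b \<in> U" "b \<notin> ?A" "a \<rightarrow>\<^bsub>G\<^esub> b"
        using \<open>u \<in> ?A\<close> by (elim R.connD[OF c, of ?A, rotated -1]) auto
      then show False using adj[of a b] H.reachable_adj_trans[of u a b] by auto
    qed
    then show "u \<rightarrow>\<^sup>*\<^bsub>G \<restriction> U\<^esub> v" using v by blast
  qed
  finally show ?thesis .
qed

theorem theorem1p4:
  fixes G :: "('a, 'b) pre_digraph" and k n :: nat
  assumes "graph G"
    and "k \<ge> 1"
    and "k_connected k G"
    and "n = card (verts G)"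
  shows "connected_density G \<ge> 1 / 2 * (1 - 1 / (2 ^ k + 1)) \<and>
         avg_connected_size G \<ge> real n / 2 * (1 - 1 / (2 ^ k + 1))"
proof -
  interpret graph G by fact
  interpret R: sgraph_rel "\<lambda>u v. u \<rightarrow>\<^bsub>G\<^esub> v"
    using arcs_ends_symmetric[OF sym_arcs] adj_not_same by unfold_locales auto
  obtain j where j: "k = Suc j" using assms(2) by (cases k) auto
  define V where "V = verts G"
  have fin: "finite V" unfolding V_def by simp
  have cs: "connected_sets G = R.cs V"
    using connected_induce_subgraph_iff[OF assms(1)] R.conn_nonempty
    unfolding connected_sets_def R.cs_def V_def by blast
  have kc: "R.k_conn k V"
    using assms(3) connected_induce_subgraph_iff[OF assms(1)]
    unfolding k_connected_def R.k_conn_def V_def by simp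
  define N where "N = real (num_connected_sets G)"
  define S where "S = real (total_connected_size G)"
  have n: "0 < n" using kc assms(4) unfolding R.k_conn_def V_def by linarith
  have "V \<in> R.cs V" using kc R.k_conn_conn unfolding j R.cs_def by blast
  then have N: "0 < N"
    unfolding N_def num_connected_sets_def cs using fin by (auto simp: card_gt_0_iff)
  have "2 ^ j * n * num_connected_sets G \<le> (2 * 2 ^ j + 1) * total_connected_size G"
    using R.sum_card_cs_ge[OF fin kc[unfolded j]] assms(4)
    unfolding num_connected_sets_def total_connected_size_def cs V_def by simp
  then have "real (2 ^ j * n * num_connected_sets G) \<le> real ((2 * 2 ^ j + 1) * total_connected_size G)"
    by (simp only: of_nat_le_iff)
  then have *: "2 ^ j * real n * N \<le> (2 * 2 ^ j + 1) * S"
    unfolding N_def S_def by (simp add: algebra_simps)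
  have p: "(0::real) < 2 * 2 ^ j + 1" by (simp add: add_pos_pos)
  \<comment> \<open>The solution of the recursion in closed form, with the index shifted by
    \<open>k = Suc j\<close>.\<close>
  have half: "1 / 2 * (1 - 1 / (2 ^ k + 1)) = 2 ^ j / (2 * 2 ^ j + 1 :: real)"
    unfolding j using p by (simp add: field_simps)
  have avg: "2 ^ j / (2 * 2 ^ j + 1) * real n \<le> avg_connected_size G"
    unfolding avg_connected_size_def N_def[symmetric] S_def[symmetric]
    using * p N by (simp add: field_simps)
  then have density: "2 ^ j / (2 * 2 ^ j + 1) \<le> connected_density G"
    unfolding connected_density_def assms(4)[symmetric] using n by (simp add: pos_le_divide_eq)
  have avg': "real n / 2 * (1 - 1 / (2 ^ k + 1)) = 2 ^ j / (2 * 2 ^ j + 1) * real n"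
    unfolding half[symmetric] by simp
  show ?thesis unfolding half avg' using density avg by blast
qed

end
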